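(* For every integer $n\ge 1$, the double triangular snake $DT_n$ is a difference graph.
   Context: A graph $G=(V,E)$ is a difference graph if there is a bijection $f$ from $V$ onto a set $S$ of positive integers such that for all distinct $x,y\in V$: $xy\in E$ if and only if $|f(x)-f(y)|\in S$. The double triangular snake $DT_n$ has vertices $u_1,\dots,u_{n+1},v_1,\dots,v_n,w_1,\dots,w_n$ and edges $u_iu_{i+1}$, $v_iu_i$, $v_iu_{i+1}$, $w_iu_i$, $w_iu_{i+1}$ for $1\le i\le n$; i.e. two triangular snakes sharing the common path $u_1u_2\cdots u_{n+1}$. *)

theory Defs
  imports Main
begin

text \<open>Graphs are simple and undirected: an edge is a two-element set of vertices.\<close>

definition simple_graph :: "'a set \<Rightarrow> 'a set set \<Rightarrow> bool" where
  "simple_graph V E \<longleftrightarrow> (\<forall>e\<in>E. \<exists>x\<in>V. \<exists>y\<in>V. x \<noteq> y \<and> e = {x, y})"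

definition difference_graph :: "'a set \<Rightarrow> 'a set set \<Rightarrow> bool" where
  "difference_graph V E \<longleftrightarrow> simple_graph V E \<and>
     (\<exists>(f :: 'a \<Rightarrow> int) S. (\<forall>s\<in>S. 0 < s) \<and> bij_betw f V S \<and>
        (\<forall>x\<in>V. \<forall>y\<in>V. x \<noteq> y \<longrightarrow> ({x, y} \<in> E \<longleftrightarrow> \<bar>f x - f y\<bar> \<in> S)))"

text \<open>The three constructors keep the families \<open>u\<^sub>i\<close>, \<open>v\<^sub>i\<close>, \<open>w\<^sub>i\<close> disjoint.
  Indices start at 1.\<close>

datatype snake_vertex = U nat | V nat | W nat

definition DT_verts :: "nat \<Rightarrow> snake_vertex set" where
  "DT_verts n = U ` {1..n + 1} \<union> V ` {1..n} \<union> W ` {1..n}"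

definition DT_edges :: "nat \<Rightarrow> snake_vertex set set" where
  "DT_edges n =
     (\<Union>i\<in>{1..n}. {{U i, U (i + 1)},
                     {V i, U i}, {V i, U (i + 1)},
                     {W i, U i}, {W i, U (i + 1)}})"

end

theory Submission
  imports Defs
begin

text \<open>Label \<open>w\<^sub>i\<close>, \<open>u\<^sub>i\<close>, \<open>v\<^sub>i\<close> by \<open>r\<^sub>i\<close>, \<open>2 r\<^sub>i\<close>, \<open>5 r\<^sub>i\<close>, where \<open>r\<^sub>i\<close> is \<open>(3/2)\<^sup>i\<close> up to a common factor
  that clears denominators. Then \<open>w\<^sub>i + w\<^sub>i = u\<^sub>i\<close>, \<open>w\<^sub>i + u\<^sub>i = u\<^sub>i\<^sub>+\<^sub>1\<close> and \<open>u\<^sub>i + u\<^sub>i\<^sub>+\<^sub>1 = v\<^sub>i\<close>, which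
  realises all edges. In a relation \<open>a r\<^sub>i + b r\<^sub>j = c r\<^sub>m\<close> with coefficients in \<open>{1, 2, 5}\<close>, divisibility
  by 3 forces the least index to occur twice, and divisibility by 2 bounds its distance to the third
  index by 1; so these are the only relations among the labels.\<close>

definition scale :: "nat \<Rightarrow> nat \<Rightarrow> int" where
  "scale N i = 3 ^ i * 2 ^ (N - i)"

lemma scale_pos: "0 < scale N i"
  by (simp add: scale_def)

lemma scale_Suc: "i < N \<Longrightarrow> 2 * scale N (Suc i) = 3 * scale N i"
proof -
  assume "i < N"
  \<comment> \<open>The bound \<open>i < N\<close> keeps the truncated subtraction in
    \<open>scale\<close> exact.\<close>
  then have "N - i = Suc (N - Suc i)" by simp
  then show ?thesis by (simp add: scale_def)
qed

lemma scale_add: "i + d \<le> N \<Longrightarrow> 2 ^ d * scale N (i + d) = 3 ^ d * scale N i"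
proof (induction d)
  case (Suc d)
  have "2 ^ Suc d * scale N (i + Suc d) = 2 ^ d * (2 * scale N (Suc (i + d)))"
    by simp
  also have "\<dots> = 3 * (2 ^ d * scale N (i + d))"
    using Suc.prems by (subst scale_Suc) auto
  also have "\<dots> = 3 ^ Suc d * scale N i"
    using Suc by simp
  finally show ?case .
qed simp

text \<open>For \<open>m = i + d\<close> the equation reduces to
  \<open>2 ^ d * s = c * 3 ^ d\<close>, so \<open>2 ^ d\<close> divides \<open>c\<close>. Only
  \<open>d = 0\<close>, or \<open>d = 1\<close> with \<open>c = 2\<close>, survives. The integer
  \<open>s\<close> is free because sums and differences of coefficients will stand there.\<close>

lemma scale_multiple:
  assumes "i \<le> m" "m \<le> N" and c: "c \<in> {1, 2, 5}"
    and eq: "s * scale N i = c * scale N m"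
  shows "m = i \<and> s = c \<or> m = Suc i \<and> s = 3 \<and> c = 2"
proof -
  obtain d where m: "m = i + d" using \<open>i \<le> m\<close> le_Suc_ex by blast
  have "(2 ^ d * s) * scale N i = 2 ^ d * (c * scale N m)"
    using eq by simp
  also have "\<dots> = c * (2 ^ d * scale N (i + d))"
    by (simp add: m)
  also have "\<dots> = (c * 3 ^ d) * scale N i"
    using assms(2) m by (simp add: scale_add)
  finally have *: "2 ^ d * s = c * 3 ^ d"
    using scale_pos[of N i] by simp
  have "2 ^ d dvd c * 3 ^ d"
    using * by (metis dvd_triv_left)
  moreover have "coprime (2 ^ d) (3 ^ d :: int)" by simp
  ultimately have dvd: "2 ^ d dvd c"
    by (simp add: coprime_dvd_mult_left_iff)
  show ?thesis
  proof (cases "d \<le> 1")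
    case True
    then consider "d = 0" | "d = 1" by linarith
    then show ?thesis
    proof cases
      case 2
      then show ?thesis using * c m by auto presburger+
    qed (use * m in auto)
  next
    case False
    then have "2 ^ 2 dvd (2 ^ d :: int)" by (intro le_imp_power_dvd) simp
    then have "(4::int) dvd c" using dvd by (auto dest: dvd_trans)
    then show ?thesis using c by auto
  qed
qed

text \<open>Modulo \<open>3 ^ Suc i\<close> the terms of index above \<open>i\<close> vanish, but
  the term of index \<open>i\<close> does not, as 3 divides neither \<open>a\<close> nor a power of
  2.\<close>

lemma scale_least_index_repeated:
  assumes "i < j" "i < m" "a \<in> {1, 2, 5, -1, -2, -5}"
  shows "a * scale N i + b * scale N j \<noteq> c * scale N m"
proof
  assume eq: "a * scale N i + b * scale N j = c * scale N m"
  have dvd: "3 ^ Suc i dvd scale N k" if "i < k" for k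
    unfolding scale_def using that by (intro dvd_mult2 le_imp_power_dvd) simp
  have "a * scale N i = c * scale N m - b * scale N j" using eq by simp
  also have "3 ^ Suc i dvd \<dots>" using dvd assms by (intro dvd_diff dvd_mult) auto
  finally have "3 ^ i * 3 dvd 3 ^ i * (a * 2 ^ (N - i))"
    by (simp add: scale_def mult_ac)
  then have "3 dvd a * 2 ^ (N - i)" by simp
  moreover have "coprime 3 (2 ^ (N - i) :: int)" by simp
  ultimately have "3 dvd a" by (simp add: coprime_dvd_mult_left_iff)
  then show False using assms(3) by auto
qed

lemma scale_sum:
  assumes le: "i \<le> N" "j \<le> N" "m \<le> N"
    and co: "a \<in> {1, 2, 5}" "b \<in> {1, 2, 5}" "c \<in> {1, 2, 5}"
    and eq: "a * scale N i + b * scale N j = c * scale N m"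
  shows "i = j \<and> m = i \<and> a = 1 \<and> b = 1 \<and> c = 2
    \<or> i = j \<and> m = Suc i \<and> a + b = 3 \<and> c = 2
    \<or> i = m \<and> j = Suc i \<and> a = 2 \<and> b = 2 \<and> c = 5
    \<or> j = m \<and> i = Suc j \<and> a = 2 \<and> b = 2 \<and> c = 5"
proof -
  have "\<not> (i < j \<and> i < m)"
    using scale_least_index_repeated[of i j m a N b c] co eq by auto
  moreover have "\<not> (j < i \<and> j < m)"
    using scale_least_index_repeated[of j i m b N a c] co eq by (auto simp: add.commute)
  \<comment> \<open>If the least index is on the right, its term is moved to the left; this is where
    negative coefficients enter.\<close>
  moreover have "\<not> (m < i \<and> m < j)"
    using scale_least_index_repeated[of m i j "- c" N a "- b"] co eq by auto
  ultimately consider "i = j" "i \<le> m" | "i = m" "i \<le> j" | "j = m" "j \<le> i"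
    by linarith
  then show ?thesis
  proof cases
    case 1
    then have "(a + b) * scale N i = c * scale N m" using eq by (simp add: algebra_simps)
    from scale_multiple[OF 1(2) le(3) co(3) this] show ?thesis using 1 co by auto
  next
    case 2
    then have "(c - a) * scale N i = b * scale N j" using eq by (simp add: algebra_simps)
    from scale_multiple[OF 2(2) le(2) co(2) this] show ?thesis using 2 co by auto
  next
    case 3
    then have "(c - b) * scale N j = a * scale N i" using eq by (simp add: algebra_simps)
    from scale_multiple[OF 3(2) le(1) co(1) this] show ?thesis using 3 co by auto
  qed
qed

fun vertex_coeff :: "snake_vertex \<Rightarrow> int" where
  "vertex_coeff (U i) = 2"
| "vertex_coeff (V i) = 5"
| "vertex_coeff (W i) = 1"

fun vertex_index :: "snake_vertex \<Rightarrow> nat" where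
  "vertex_index (U i) = i"
| "vertex_index (V i) = i"
| "vertex_index (W i) = i"

text \<open>The parameter \<open>n + 1\<close> is the largest index of a vertex, attained by the end
  of the path.\<close>

definition snake_label :: "nat \<Rightarrow> snake_vertex \<Rightarrow> int" where
  "snake_label n x = vertex_coeff x * scale (n + 1) (vertex_index x)"

lemma vertex_coeff_range: "vertex_coeff x \<in> {1, 2, 5}"
  by (cases x) auto

lemma vertex_index_le: "x \<in> DT_verts n \<Longrightarrow> vertex_index x \<le> n + 1"
  by (auto simp: DT_verts_def)

lemma snake_vertex_eqI:
  "vertex_coeff x = vertex_coeff y \<Longrightarrow> vertex_index x = vertex_index y \<Longrightarrow> x = y"
  by (cases x; cases y) auto

lemma snake_label_pos: "0 < snake_label n x"
  using scale_pos by (cases x) (auto simp: snake_label_def)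

lemma inj_on_snake_label: "inj_on (snake_label n) (DT_verts n)"
proof -
  have *: "x = y"
    if "x \<in> DT_verts n" "y \<in> DT_verts n" "snake_label n x = snake_label n y"
      "vertex_index x \<le> vertex_index y" for x y
    \<comment> \<open>The exceptional case of \<open>scale_multiple\<close> would need the
      coefficient 3, which no vertex has.\<close>
    using scale_multiple[OF that(4) vertex_index_le[OF that(2)] vertex_coeff_range
        that(3)[unfolded snake_label_def]] vertex_coeff_range[of x]
    by (auto intro: snake_vertex_eqI)
  show ?thesis
    by (rule inj_onI) (metis * nle_le)
qed

lemma DT_edges_iff:
  "{x, y} \<in> DT_edges n \<longleftrightarrow> (\<exists>i\<in>{1..n}.
     {x, y} = {U i, U (i + 1)} \<or> {x, y} = {V i, U i} \<or> {x, y} = {V i, U (i + 1)} \<or>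
     {x, y} = {W i, U i} \<or> {x, y} = {W i, U (i + 1)})"
  by (auto simp: DT_edges_def)

lemma snake_label_sum_imp_edge:
  assumes "x \<in> DT_verts n" "y \<in> DT_verts n" "z \<in> DT_verts n"
    and "snake_label n x + snake_label n y = snake_label n z"
  shows "{x, z} \<in> DT_edges n"
proof -
  note rel = scale_sum[OF assms(1-3)[THEN vertex_index_le]
      vertex_coeff_range vertex_coeff_range vertex_coeff_range
      assms(4)[unfolded snake_label_def]]
  show ?thesis
    using rel assms(1-3)
    \<comment> \<open>Each possible relation contains \<open>W i\<close> or \<open>V i\<close>, and
      membership of that vertex puts \<open>i\<close> into \<open>{1..n}\<close>, as an edge
      requires.\<close>
    by (cases x; cases y; cases z)
      (auto simp: DT_verts_def DT_edges_iff doubleton_eq_iff)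
qed

lemma edge_imp_snake_label_diff:
  assumes "{x, y} \<in> DT_edges n"
  shows "\<bar>snake_label n x - snake_label n y\<bar> \<in> snake_label n ` DT_verts n"
proof -
  obtain i where i: "i \<in> {1..n}" and
    e: "{x, y} = {U i, U (i + 1)} \<or> {x, y} = {V i, U i} \<or> {x, y} = {V i, U (i + 1)} \<or>
     {x, y} = {W i, U i} \<or> {x, y} = {W i, U (i + 1)}"
    using assms unfolding DT_edges_iff by blast
  let ?f = "snake_label n"
  have mem: "U i \<in> DT_verts n" "U (i + 1) \<in> DT_verts n" "W i \<in> DT_verts n"
    using i by (auto simp: DT_verts_def)
  have 2: "2 * scale (n + 1) (Suc i) = 3 * scale (n + 1) i"
    using i by (intro scale_Suc) auto
  \<comment> \<open>In each equation the sum is adjacent to both summands, and the difference along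
    either edge is the other summand. This accounts for all five edges at \<open>i\<close>.\<close>
  have "?f (W i) + ?f (W i) = ?f (U i)" "?f (W i) + ?f (U i) = ?f (U (i + 1))"
    "?f (U i) + ?f (U (i + 1)) = ?f (V i)"
    using 2 by (auto simp: snake_label_def)
  then have "\<bar>?f x - ?f y\<bar> \<in> {?f (U i), ?f (U (i + 1)), ?f (W i)}"
    using e snake_label_pos[of n "W i"] snake_label_pos[of n "U i"]
      snake_label_pos[of n "U (i + 1)"]
    unfolding doubleton_eq_iff by (elim disjE conjE) simp_all
  then show ?thesis using mem by blast
qed

lemma simple_graph_DT: "simple_graph (DT_verts n) (DT_edges n)"
  unfolding simple_graph_def
proof
  fix e assume "e \<in> DT_edges n"
  then obtain i where i: "i \<in> {1..n}" and
    e: "e \<in> {{U i, U (i + 1)}, {V i, U i}, {V i, U (i + 1)}, {W i, U i}, {W i, U (i + 1)}}"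
    unfolding DT_edges_def by blast
  have "U i \<in> DT_verts n" "U (i + 1) \<in> DT_verts n" "V i \<in> DT_verts n" "W i \<in> DT_verts n"
    using i by (auto simp: DT_verts_def)
  moreover have "U i \<noteq> U (i + 1)" "V i \<noteq> U i" "V i \<noteq> U (i + 1)" "W i \<noteq> U i" "W i \<noteq> U (i + 1)"
    by auto
  ultimately show "\<exists>x\<in>DT_verts n. \<exists>y\<in>DT_verts n. x \<noteq> y \<and> e = {x, y}"
    using e by blast
qed

theorem theorem3p6:
  fixes n :: nat
  assumes "n \<ge> 1"
  shows "difference_graph (DT_verts n) (DT_edges n)"
proof -
  let ?f = "snake_label n" and ?S = "snake_label n ` DT_verts n"
  have "{x, y} \<in> DT_edges n"
    if "x \<in> DT_verts n" "y \<in> DT_verts n" "\<bar>?f x - ?f y\<bar> \<in> ?S" for x y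
  proof -
    obtain z where z: "z \<in> DT_verts n" "\<bar>?f x - ?f y\<bar> = ?f z"
      using \<open>\<bar>?f x - ?f y\<bar> \<in> ?S\<close> by blast
    \<comment> \<open>Resolving the absolute value makes the larger label a sum of two labels, the
      form classified above.\<close>
    then consider "?f y + ?f z = ?f x" | "?f x + ?f z = ?f y" by linarith
    then show ?thesis
      using snake_label_sum_imp_edge[of y n z x] snake_label_sum_imp_edge[of x n z y] that z(1)
      by cases (auto simp: insert_commute)
  qed
  then have "\<forall>x\<in>DT_verts n. \<forall>y\<in>DT_verts n. x \<noteq> y \<longrightarrow>
      ({x, y} \<in> DT_edges n \<longleftrightarrow> \<bar>?f x - ?f y\<bar> \<in> ?S)"
    using edge_imp_snake_label_diff by blast
  moreover have "\<forall>s\<in>?S. 0 < s" using snake_label_pos by blast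
  moreover have "bij_betw ?f (DT_verts n) ?S"
    using inj_on_snake_label by (rule inj_on_imp_bij_betw)
  ultimately show ?thesis
    unfolding difference_graph_def using simple_graph_DT by blast
qed

end
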